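(* Let $D$ be a finite digraph such that each block of $D$ is strongly connected or a single arc. Let $\mathcal F(D)$ be the set of directed cycles of $D$ and $\mu(D)$ the cycle rank of $D$. Then $D$ admits a forward fundamental cycle basis if and only if $$|\mathcal F(D)|=\mu(D).$$ In this case, $\mathcal F(D)$ constitutes the unique forward cycle basis of $D$.
   Context: Let $D$ be a finite digraph with vertex set $V(D)$ and arc set $A(D)$. A cycle in $D$ is a closed walk (with at least one arc, arcs pairwise distinct, arcs may be traversed in either direction) whose vertices are distinct except that the first equals the last; it is a directed cycle if every arc is traversed in its own direction. The incidence vector of a cycle $C$ has entry $1$ on arcs traversed forward, $-1$ on arcs traversed backward, $0$ on other arcs; cycles are identified with their incidence vectors (so directed cycles are counted up to choice of starting vertex). The cycle space is $\mathcal C_{\mathbb R}(D)=\{x\in \mathbb R^{A(D)} : \sum_{e\in\delta^+(v)}x(e)=\sum_{e\in\delta^-(v)}x(e)\ \forall v\in V(D)\}$; its dimension is the cycle rank $\mu(D)$. A cycle basis is a basis of $\mathcal C_{\mathbb R}(D)$ consisting of cycles. It is forward if all its cycles are directed cycles. It is (strictly) fundamental if there is a spanning forest $T$ of $D$ (a subgraph with vertex set $V(D)$ containing no cycle) such that the basis is $\{C_T^{(e)} : e\in A(D)\setminus A(T)\}$, where $C_T^{(e)}$ is the only cycle (up to orientation, either of which may be chosen) contained in $T\cup\{e\}$. A digraph is separable if deleting some vertex leaves a digraph that is not weakly connected. The blocks of $D$ are its maximal non-separable (weakly connected) subgraphs. *)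

theory Defs
  imports
    Complex_Main
    "HOL-Library.Function_Algebras"
    "Graph_Theory.Graph_Theory"
begin

text \<open>
  Digraphs are those of the Graph-Theory library, so loops and parallel arcs are allowed. The
  space \<open>\<real>\<^sup>A\<^sup>(\<^sup>D\<^sup>)\<close> is rendered as the functions from the arc type to the reals that vanish
  outside \<^term>\<open>arcs D\<close>.
\<close>

definition arc_scale :: "real \<Rightarrow> ('b \<Rightarrow> real) \<Rightarrow> 'b \<Rightarrow> real" where
  "arc_scale c x = (\<lambda>e. c * x e)"

global_interpretation arc_space: vector_space "arc_scale :: real \<Rightarrow> ('b \<Rightarrow> real) \<Rightarrow> 'b \<Rightarrow> real"
  by unfold_locales (auto simp: arc_scale_def algebra_simps fun_eq_iff)

text \<open>
  The arc \<open>(e, True)\<close> is \<open>e\<close> traversed forward, and \<open>(e, False)\<close> is \<open>e\<close> traversed backward.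
\<close>

definition two_way :: "('a, 'b) pre_digraph \<Rightarrow> ('a, 'b \<times> bool) pre_digraph" where
  "two_way D =
    \<lparr>verts = verts D,
     arcs = arcs D \<times> UNIV,
     tail = (\<lambda>(e, fwd). if fwd then tail D e else head D e),
     head = (\<lambda>(e, fwd). if fwd then head D e else tail D e)\<rparr>"

text \<open>
  The distinctness condition only excludes going back and forth along one non-loop arc.
\<close>

definition cycle_walk :: "('a, 'b) pre_digraph \<Rightarrow> ('b \<times> bool) list \<Rightarrow> bool" where
  "cycle_walk D p \<longleftrightarrow> pre_digraph.cycle (two_way D) p \<and> distinct (map fst p)"

definition incidence_vector :: "('b \<times> bool) list \<Rightarrow> 'b \<Rightarrow> real" where
  "incidence_vector p e =
    (if (e, True) \<in> set p then 1 else if (e, False) \<in> set p then -1 else 0)"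

definition cycles :: "('a, 'b) pre_digraph \<Rightarrow> ('b \<Rightarrow> real) set" where
  "cycles D = {incidence_vector p |p. cycle_walk D p}"

definition directed_cycles :: "('a, 'b) pre_digraph \<Rightarrow> ('b \<Rightarrow> real) set" where
  "directed_cycles D = {incidence_vector p |p. cycle_walk D p \<and> (\<forall>(e, fwd) \<in> set p. fwd)}"

definition cycle_space :: "('a, 'b) pre_digraph \<Rightarrow> ('b \<Rightarrow> real) set" where
  "cycle_space D =
    {x. (\<forall>e. e \<notin> arcs D \<longrightarrow> x e = 0) \<and>
        (\<forall>v \<in> verts D. (\<Sum>e \<in> out_arcs D v. x e) = (\<Sum>e \<in> in_arcs D v. x e))}"

definition cycle_rank :: "('a, 'b) pre_digraph \<Rightarrow> nat" where
  "cycle_rank D = arc_space.dim (cycle_space D)"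

definition cycle_basis :: "('a, 'b) pre_digraph \<Rightarrow> ('b \<Rightarrow> real) set \<Rightarrow> bool" where
  "cycle_basis D B \<longleftrightarrow>
    B \<subseteq> cycles D \<and> arc_space.independent B \<and> arc_space.span B = cycle_space D"

definition forward_cycle_basis :: "('a, 'b) pre_digraph \<Rightarrow> ('b \<Rightarrow> real) set \<Rightarrow> bool" where
  "forward_cycle_basis D B \<longleftrightarrow> cycle_basis D B \<and> B \<subseteq> directed_cycles D"

text \<open>
  The library's \<^const>\<open>forest\<close> only excludes directed cycles, hence it is not used here.
\<close>

definition spanning_forest :: "('a, 'b) pre_digraph \<Rightarrow> ('a, 'b) pre_digraph \<Rightarrow> bool" where
  "spanning_forest T D \<longleftrightarrow> spanning T D \<and> cycles T = {}"

text \<open>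
  The vector \<open>c\<close> is the only cycle of \<open>T \<union> {e}\<close> up to orientation. The choice of an orientation
  for each non-tree arc is the function \<open>C\<close> in the next definition.
\<close>

definition fundamental_cycle ::
    "('a, 'b) pre_digraph \<Rightarrow> 'b \<Rightarrow> ('b \<Rightarrow> real) \<Rightarrow> bool" where
  "fundamental_cycle T e c \<longleftrightarrow> cycles (pre_digraph.add_arc T e) = {c, - c}"

definition fundamental_cycle_basis :: "('a, 'b) pre_digraph \<Rightarrow> ('b \<Rightarrow> real) set \<Rightarrow> bool" where
  "fundamental_cycle_basis D B \<longleftrightarrow>
    cycle_basis D B \<and>
    (\<exists>T C. spanning_forest T D \<and>
           (\<forall>e \<in> arcs D - arcs T. fundamental_cycle T e (C e)) \<and>
           B = C ` (arcs D - arcs T))"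

text \<open>
  The library's \<^const>\<open>connected\<close> is weak connectivity, but it is false for the digraph without
  vertices. Deleting the only vertex of a digraph shall not make it separable, so this case is
  excluded explicitly.
\<close>

definition separable :: "('a, 'b) pre_digraph \<Rightarrow> bool" where
  "separable D \<longleftrightarrow>
    (\<exists>v \<in> verts D. verts (pre_digraph.del_vert D v) \<noteq> {} \<and>
                   \<not> connected (pre_digraph.del_vert D v))"

definition block :: "('a, 'b) pre_digraph \<Rightarrow> ('a, 'b) pre_digraph \<Rightarrow> bool" where
  "block D B \<longleftrightarrow> pre_digraph.max_subgraph D (\<lambda>H. connected H \<and> \<not> separable H) B"

definition single_arc :: "('a, 'b) pre_digraph \<Rightarrow> bool" where
  "single_arc D \<longleftrightarrow> (\<exists>e. arcs D = {e} \<and> verts D = {tail D e, head D e})"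

end

theory Submission
  imports Defs
begin

text \<open>
  Every nonnegative circulation is a nonnegative combination of directed cycles. Under the block
  hypothesis an arc outside all directed cycles is a bridge and carries no circulation, so adding
  a large multiple of the sum of all directed cycles makes any circulation nonnegative. Hence the
  directed cycles span the cycle space, and \<open>|F(D)| = \<mu>(D)\<close> says that they form a basis.

  In that case the cone of nonnegative circulations is simplicial with the directed cycles as its
  extreme rays. Its facets have the form \<open>x(e) = 0\<close>, so each directed cycle has an arc that lies on
  no other directed cycle. Deleting one such arc per directed cycle leaves a forest whose
  fundamental cycles are the directed cycles. Conversely, the coordinates of a directed cycle with
  respect to a forward fundamental basis are its values on the non-forest arcs, hence 0 or 1. So
  it contains a basis cycle, and by minimality of the supports it is equal to it.
\<close>

subsection \<open>Circulations and undirected cycles\<close>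

text \<open>A single sum over all arcs makes linearity in \<open>x\<close> immediate and allows
  exchanging sums over vertex sets. A loop contributes 0 at its vertex.\<close>

definition net_outflow :: "('a, 'b) pre_digraph \<Rightarrow> ('b \<Rightarrow> real) \<Rightarrow> 'a \<Rightarrow> real" where
  "net_outflow D x v = (\<Sum>e\<in>arcs D. x e * (of_bool (tail D e = v) - of_bool (head D e = v)))"

lemma net_outflow_add: "net_outflow D (\<lambda>e. x e + y e) v = net_outflow D x v + net_outflow D y v"
  by (simp add: net_outflow_def algebra_simps sum.distrib sum_subtractf)

lemma net_outflow_scale: "net_outflow D (\<lambda>e. t * x e) v = t * net_outflow D x v"
  by (simp add: net_outflow_def sum_distrib_left mult.assoc)

lemma net_outflow_single:
  assumes "finite (arcs D)" "e \<in> arcs D"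
  shows "net_outflow D (\<lambda>e'. if e' = e then t else 0) v
    = t * (of_bool (tail D e = v) - of_bool (head D e = v))"
proof -
  have "net_outflow D (\<lambda>e'. if e' = e then t else 0) v
    = (\<Sum>e'\<in>arcs D. if e' = e then t * (of_bool (tail D e = v) - of_bool (head D e = v)) else 0)"
    unfolding net_outflow_def by (rule sum.cong) auto
  then show ?thesis using assms by simp
qed

text \<open>Points outside \<open>verts G\<close> meet no arc by well-formedness, so conservation
  can be stated for every \<open>v\<close>.\<close>

lemma (in fin_digraph) cycle_space_iff_net_outflow:
  "x \<in> cycle_space G \<longleftrightarrow> (\<forall>e. e \<notin> arcs G \<longrightarrow> x e = 0) \<and> (\<forall>v. net_outflow G x v = 0)"
proof -
  have *: "net_outflow G x v = (\<Sum>e\<in>out_arcs G v. x e) - (\<Sum>e\<in>in_arcs G v. x e)" for v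
  proof -
    have if_of_bool: "x e * of_bool P = (if P then x e else 0)" for e P by simp
    show ?thesis
      unfolding net_outflow_def out_arcs_def in_arcs_def right_diff_distrib sum_subtractf if_of_bool
      by (simp add: sum.inter_filter)
  qed
  have "out_arcs G v = {}" "in_arcs G v = {}" if "v \<notin> verts G" for v
    using that by (auto simp: out_arcs_def in_arcs_def)
  then show ?thesis unfolding cycle_space_def * by force
qed

lemma (in fin_digraph) subspace_cycle_space: "arc_space.subspace (cycle_space G)"
proof -
  have "net_outflow G 0 v = 0" for v by (simp add: net_outflow_def)
  then show ?thesis
    unfolding arc_space.subspace_def arc_scale_def plus_fun_def
    by (simp add: cycle_space_iff_net_outflow net_outflow_add net_outflow_scale)
qed

section \<open>Incidence vectors of walks that traverse arcs in either direction\<close>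

lemma two_way_simps [simp]:
  "verts (two_way D) = verts D"
  "arcs (two_way D) = arcs D \<times> UNIV"
  "tail (two_way D) (e, b) = (if b then tail D e else head D e)"
  "head (two_way D) (e, b) = (if b then head D e else tail D e)"
  by (auto simp: two_way_def)

lemma (in wf_digraph) wf_two_way: "wf_digraph (two_way G)"
  by unfold_locales (auto simp: two_way_def)

lemma compatible_two_way: "compatible D H \<Longrightarrow> compatible (two_way D) (two_way H)"
  by (auto simp: compatible_def two_way_def)

lemma incidence_vector_Nil [simp]: "incidence_vector [] = 0"
  by (auto simp: incidence_vector_def)

text \<open>Distinctness makes the vector of \<open>p\<close> vanish at \<open>e\<close>, so the
  first arc contributes additively. This drives inductions along walks.\<close>

lemma incidence_vector_Cons:
  assumes "distinct (map fst ((e, b) # p))"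
  shows "incidence_vector ((e, b) # p) =
    (\<lambda>e'. (if e' = e then if b then 1 else -1 else 0) + incidence_vector p e')"
  using assms by (auto simp: incidence_vector_def image_iff fun_eq_iff)

lemma incidence_vector_eq_0_iff: "incidence_vector p e = 0 \<longleftrightarrow> e \<notin> fst ` set p"
proof -
  have "e \<in> fst ` set p \<longleftrightarrow> (\<exists>b. (e, b) \<in> set p)"
    by force
  then show ?thesis by (simp add: incidence_vector_def ex_bool_eq)
qed

text \<open>The contributions of consecutive arcs cancel at the vertex between them, so the sum
  telescopes to the two ends of the walk. A closed walk therefore gives a circulation.\<close>

lemma net_outflow_incidence_vector:
  assumes "finite (arcs D)" "pre_digraph.cas (two_way D) u p w"
    "fst ` set p \<subseteq> arcs D" "distinct (map fst p)"
  shows "net_outflow D (incidence_vector p) v = of_bool (u = v) - of_bool (w = v)"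
  using assms(2-)
proof (induction p arbitrary: u)
  case Nil
  then show ?case by (simp add: pre_digraph.cas.simps net_outflow_def)
next
  case (Cons a p)
  obtain e b where [simp]: "a = (e, b)" by (cases a)
  have prems: "u = tail (two_way D) a" "pre_digraph.cas (two_way D) (head (two_way D) a) p w"
    "e \<in> arcs D" "fst ` set p \<subseteq> arcs D" "distinct (map fst p)" "distinct (map fst ((e, b) # p))"
    using Cons.prems by (auto simp: pre_digraph.cas.simps)
  show ?case
    using Cons.IH[OF prems(2,4,5)] prems(1) assms(1) prems(3)
    by (simp add: incidence_vector_Cons[OF prems(6)] net_outflow_add net_outflow_single)
qed

lemma (in fin_digraph) cycles_subset_cycle_space: "cycles G \<subseteq> cycle_space G"
proof
  fix c assume "c \<in> cycles G"
  then obtain p u where p: "c = incidence_vector p" "distinct (map fst p)"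
    "pre_digraph.cas (two_way G) u p u" "set p \<subseteq> arcs G \<times> UNIV"
    by (auto simp: cycles_def cycle_walk_def pre_digraph.cycle_def pre_digraph.awalk_def)
  then have "fst ` set p \<subseteq> arcs G" by auto
  with p show "c \<in> cycle_space G"
    by (auto simp: cycle_space_iff_net_outflow incidence_vector_eq_0_iff net_outflow_incidence_vector)
qed

lemma zero_notin_cycles:
  fixes D :: "('a, 'b) pre_digraph"
  shows "0 \<notin> cycles D"
proof
  assume "0 \<in> cycles D"
  then obtain p :: "('b \<times> bool) list" where "0 = incidence_vector p" "p \<noteq> []"
    unfolding cycles_def cycle_walk_def pre_digraph.cycle_def mem_Collect_eq by (metis (no_types))
  then show False
    using incidence_vector_eq_0_iff[of p "fst (hd p)"] by (metis hd_in_set imageI zero_fun_apply)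
qed

lemma cycles_range: "c \<in> cycles D \<Longrightarrow> c e \<in> {-1, 0, 1}"
  unfolding cycles_def by (clarsimp simp: incidence_vector_def split: if_splits)

section \<open>Cycles of subgraphs\<close>

lemma cycle_walk_subgraph_iff:
  assumes "subgraph H D"
  shows "cycle_walk H p \<longleftrightarrow> cycle_walk D p \<and> fst ` set p \<subseteq> arcs H"
proof -
  have comp: "compatible D H" and wf: "wf_digraph H" and sub: "verts H \<subseteq> verts D" "arcs H \<subseteq> arcs D"
    using assms by (auto simp: subgraph_def)
  note c = compatible_cas[OF compatible_two_way[OF comp]]
    compatible_awalk_verts[OF compatible_two_way[OF comp]]
  have sp: "set p \<subseteq> arcs X \<times> UNIV \<longleftrightarrow> fst ` set p \<subseteq> arcs X" for X :: "('a, 'b) pre_digraph"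
    by force
  have "pre_digraph.awalk (two_way H) u p u \<longleftrightarrow>
      pre_digraph.awalk (two_way D) u p u \<and> fst ` set p \<subseteq> arcs H" if "p \<noteq> []" for u
  proof -
    \<comment> \<open>The base vertex is an end of the first arc, which lies in \<open>H\<close>
      because \<open>p\<close> is nonempty.\<close>
    have "u \<in> verts H" if "pre_digraph.cas (two_way H) u p u" "fst ` set p \<subseteq> arcs H"
      using that \<open>p \<noteq> []\<close> wf by (cases p) (auto simp: pre_digraph.cas.simps wf_digraph_def)
    then show ?thesis
      unfolding pre_digraph.awalk_def c two_way_simps sp using sub by blast
  qed
  then show ?thesis
    unfolding cycle_walk_def pre_digraph.cycle_def c by blast
qed

text \<open>The support of an incidence vector is the set of arcs used. Cycles of a forest, with or
  without an extra arc, can thus be handled as vectors with restricted support.\<close>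

lemma cycles_subgraph:
  assumes "subgraph H D"
  shows "cycles H = {c \<in> cycles D. \<forall>e. e \<notin> arcs H \<longrightarrow> c e = 0}"
proof -
  have "(\<forall>e. e \<notin> arcs H \<longrightarrow> incidence_vector p e = 0) \<longleftrightarrow> fst ` set p \<subseteq> arcs H" for p
    by (auto simp: incidence_vector_eq_0_iff)
  then show ?thesis
    unfolding cycles_def by (auto simp: cycle_walk_subgraph_iff[OF assms])
qed

section \<open>Reversal of cycles\<close>

definition reverse_walk :: "('b \<times> bool) list \<Rightarrow> ('b \<times> bool) list" where
  "reverse_walk p = rev (map (\<lambda>(e, b). (e, \<not> b)) p)"

lemma reverse_walk_Cons: "reverse_walk ((e, b) # p) = reverse_walk p @ [(e, \<not> b)]"
  by (simp add: reverse_walk_def)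

lemma cas_reverse_walk:
  assumes "pre_digraph.cas (two_way D) u p w"
  shows "pre_digraph.cas (two_way D) w (reverse_walk p) u"
  using assms
proof (induction p arbitrary: u)
  case (Cons a p)
  obtain e b where [simp]: "a = (e, b)" by (cases a)
  have "pre_digraph.cas (two_way D) w (reverse_walk p) (head (two_way D) a)"
    using Cons by (auto simp: pre_digraph.cas.simps)
  moreover have "pre_digraph.cas (two_way D) (head (two_way D) a) [(e, \<not> b)] u"
    using Cons.prems by (cases b) (auto simp: pre_digraph.cas.simps)
  moreover have "pre_digraph.cas (two_way D) x (q @ r) z"
    if "pre_digraph.cas (two_way D) x q y" "pre_digraph.cas (two_way D) y r z" for x y z q r
    using that by (induction q arbitrary: x) (simp_all add: pre_digraph.cas.simps)
  ultimately show ?case by (simp add: reverse_walk_Cons)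
qed (simp add: reverse_walk_def pre_digraph.cas.simps)

text \<open>Each head is the next tail. For \<open>u = w\<close> the tails and the heads agree as
  multisets.\<close>

lemma (in pre_digraph) map_tail_eq_map_head:
  "cas u p w \<Longrightarrow> map (tail G) p @ [w] = u # map (head G) p"
  by (induction p arbitrary: u) auto

lemma (in pre_digraph) cycle_iff_distinct_heads:
  "cycle p \<longleftrightarrow> (\<exists>u. awalk u p u \<and> distinct (map (head G) p) \<and> p \<noteq> [])"
  unfolding cycle_def by (auto simp: awalk_def awalk_verts_conv')

text \<open>The heads of the reversed walk are the tails of the original one. On a closed walk these
  are the same multiset as the heads, hence distinct as well.\<close>

lemma cycle_walk_reverse_walk:
  assumes "cycle_walk D p"
  shows "cycle_walk D (reverse_walk p)"
proof -
  obtain u where p: "u \<in> verts D" "set p \<subseteq> arcs D \<times> UNIV" "p \<noteq> []" "distinct (map fst p)"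
    and cas: "pre_digraph.cas (two_way D) u p u"
    and dist: "distinct (map (head (two_way D)) p)"
    using assms unfolding cycle_walk_def pre_digraph.cycle_iff_distinct_heads pre_digraph.awalk_def
      two_way_simps by (elim conjE exE) (rule that)
  have "mset (map (tail (two_way D)) p) = mset (map (head (two_way D)) p)"
    using arg_cong[where f = mset, OF pre_digraph.map_tail_eq_map_head[OF cas]] by simp
  then have "distinct (map (tail (two_way D)) p)"
    using dist mset_eq_imp_distinct_iff by blast
  moreover have "map (head (two_way D)) (reverse_walk p) = rev (map (tail (two_way D)) p)"
    by (auto simp: reverse_walk_def rev_map)
  moreover have "map fst (reverse_walk p) = rev (map fst p)"
    by (auto simp: reverse_walk_def rev_map)
  moreover have "set (reverse_walk p) \<subseteq> arcs D \<times> UNIV" "reverse_walk p \<noteq> []"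
    using p(2,3) by (auto simp: reverse_walk_def)
  ultimately show ?thesis
    using p cas_reverse_walk[OF cas]
    unfolding cycle_walk_def pre_digraph.cycle_iff_distinct_heads pre_digraph.awalk_def
      two_way_simps by (intro conjI exI[of _ u]) simp_all
qed

lemma uminus_cycles:
  assumes "c \<in> cycles D"
  shows "- c \<in> cycles D"
proof -
  obtain p where p: "c = incidence_vector p" "cycle_walk D p"
    using assms by (auto simp: cycles_def)
  have "(e, b) \<in> set (reverse_walk p) \<longleftrightarrow> (e, \<not> b) \<in> set p" for e b
    by (force simp: reverse_walk_def)
  \<comment> \<open>\<open>incidence_vector\<close> tests the forward copy first, so the sign change
    relies on no arc occurring in both directions.\<close>
  moreover have "\<not> ((e, True) \<in> set p \<and> (e, False) \<in> set p)" for e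
    using p(2) unfolding cycle_walk_def distinct_map by (metis fst_conv inj_onD snd_conv)
  ultimately have "- c = incidence_vector (reverse_walk p)"
    using p(1) by (auto simp: incidence_vector_def fun_eq_iff)
  then show ?thesis using cycle_walk_reverse_walk[OF p(2)] by (auto simp: cycles_def)
qed

subsection \<open>Directed cycles and nonnegative circulations\<close>

text \<open>Arcs with distinct heads are distinct, which yields the condition on
  \<open>map fst\<close>. Directed cycles thereby become the library's \<open>cycle\<close>.\<close>

lemma (in wf_digraph) cycle_walk_forward_iff:
  "cycle_walk G (map (\<lambda>e. (e, True)) q) \<longleftrightarrow> cycle q"
proof -
  have cas: "pre_digraph.cas (two_way G) u (map (\<lambda>e. (e, True)) q) w \<longleftrightarrow> cas u q w" for u w
    by (induction q arbitrary: u) (auto simp: pre_digraph.cas.simps)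
  have "set (map (\<lambda>e. (e, True)) q) \<subseteq> arcs G \<times> UNIV \<longleftrightarrow> set q \<subseteq> arcs G"
    by auto
  then show ?thesis
    unfolding cycle_walk_def pre_digraph.cycle_iff_distinct_heads pre_digraph.awalk_def two_way_simps cas
    by (auto simp: o_def distinct_map)
qed

lemma (in wf_digraph) directed_cycles_eq:
  "directed_cycles G = (\<lambda>q e. of_bool (e \<in> set q)) ` {q. cycle q}"
proof -
  have *: "p = map (\<lambda>e. (e, True)) (map fst p)" if "\<forall>(e, fwd)\<in>set p. fwd" for p :: "('b \<times> bool) list"
    using that by (induction p) auto
  have "{p. cycle_walk G p \<and> (\<forall>(e, fwd)\<in>set p. fwd)} = map (\<lambda>e. (e, True)) ` {q. cycle q}"
  proof (intro equalityI subsetI)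
    fix p assume "p \<in> {p. cycle_walk G p \<and> (\<forall>(e, fwd)\<in>set p. fwd)}"
    with * have "p = map (\<lambda>e. (e, True)) (map fst p)" "cycle_walk G p" by auto
    then show "p \<in> map (\<lambda>e. (e, True)) ` {q. cycle q}"
      using cycle_walk_forward_iff[of "map fst p"] by (intro image_eqI[where x = "map fst p"]) simp_all
  next
    fix p assume "p \<in> map (\<lambda>e. (e, True)) ` {q. cycle q}"
    then show "p \<in> {p. cycle_walk G p \<and> (\<forall>(e, fwd)\<in>set p. fwd)}"
      using cycle_walk_forward_iff by auto
  qed
  moreover have "incidence_vector (map (\<lambda>e. (e, True)) q) = (\<lambda>e. of_bool (e \<in> set q))" for q :: "'b list"
    by (auto simp: incidence_vector_def)
  moreover have "directed_cycles G = incidence_vector ` {p. cycle_walk G p \<and> (\<forall>(e, fwd)\<in>set p. fwd)}"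
    by (auto simp: directed_cycles_def)
  ultimately show ?thesis by (simp add: image_image)
qed

lemma directed_cycles_subset_cycles: "directed_cycles D \<subseteq> cycles D"
  by (auto simp: directed_cycles_def cycles_def)

lemma (in wf_digraph) directed_cycles_range: "c \<in> directed_cycles G \<Longrightarrow> c e = 0 \<or> c e = 1"
  by (auto simp: directed_cycles_eq)

lemma (in fin_digraph) finite_directed_cycles: "finite (directed_cycles G)"
proof -
  have "{q. cycle q} \<subseteq> {q. set q \<subseteq> arcs G \<and> distinct q}"
    by (auto simp: cycle_iff_distinct_heads awalk_def distinct_map)
  then show ?thesis
    unfolding directed_cycles_eq
    by (intro finite_imageI) (rule finite_subset[OF _ finite_subset_distinct[OF finite_arcs]])
qed

lemma (in fin_digraph) directed_cycles_subset_cycle_space: "directed_cycles G \<subseteq> cycle_space G"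
  using directed_cycles_subset_cycles cycles_subset_cycle_space by blast

section \<open>Supports of circulations and decomposition into directed cycles\<close>

text \<open>The first vertex of the path meets only the first arc of the support, so conservation
  there forces the value 0. Induction then removes that arc.\<close>

lemma (in fin_digraph) circulation_on_path_eq_0:
  assumes "x \<in> cycle_space G" "cas u p w" "set p \<subseteq> arcs G" "distinct (awalk_verts u p)"
    and "\<And>e. e \<notin> set p \<Longrightarrow> x e = 0"
  shows "x = 0"
  using assms(2-)
proof (induction p arbitrary: u)
  case (Cons a p)
  have a: "tail G a = u" "cas (head G a) p w" "u \<notin> set (awalk_verts (head G a) p)" "a \<in> arcs G"
    "distinct (awalk_verts (head G a) p)"
    using Cons.prems by auto
  note vs = set_awalk_verts_cas[OF a(2)]
  have away: "tail G e \<noteq> u" "head G e \<noteq> u" if "e \<in> set p" for e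
    using that a(3) unfolding vs by auto
  have head_a: "head G a \<noteq> u" using a(3) unfolding vs by auto
  have "net_outflow G x u = (\<Sum>e\<in>{a}. x e * (of_bool (tail G e = u) - of_bool (head G e = u)))"
    unfolding net_outflow_def
  proof (rule sum.mono_neutral_right)
    show "\<forall>e\<in>arcs G - {a}. x e * (of_bool (tail G e = u) - of_bool (head G e = u)) = 0"
    proof
      fix e assume "e \<in> arcs G - {a}"
      then show "x e * (of_bool (tail G e = u) - of_bool (head G e = u)) = 0"
        using away[of e] Cons.prems(4)[of e] by (cases "e \<in> set p") auto
    qed
  qed (use a(4) in auto)
  then have "x a = 0"
    using a(1) head_a assms(1) by (simp add: cycle_space_iff_net_outflow)
  then show ?case
    using Cons.IH[OF a(2) _ a(5)] Cons.prems(2,4)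
    by (metis insert_iff list.simps(15) set_subset_Cons subset_trans)
qed auto

text \<open>Subtracting the multiple of \<open>c\<close> that agrees with \<open>x\<close> at one
  arc of the cycle leaves a circulation supported on a path, which is 0.\<close>

lemma (in fin_digraph) directed_cycle_minimal_support:
  assumes "c \<in> directed_cycles G" "x \<in> cycle_space G" "\<And>e. c e = 0 \<Longrightarrow> x e = 0"
  shows "\<exists>t. x = arc_scale t c"
proof -
  obtain q where q: "cycle q" and c: "c = (\<lambda>e. of_bool (e \<in> set q))"
    using assms(1) by (auto simp: directed_cycles_eq)
  obtain a p u where p: "q = a # p" "cas (head G a) p u" "set q \<subseteq> arcs G"
    "distinct (awalk_verts (head G a) p)"
    using q by (cases q) (auto simp: cycle_def awalk_def)
  define y where "y = x - arc_scale (x a) c"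
  have "y \<in> cycle_space G"
    unfolding y_def using assms directed_cycles_subset_cycle_space
    by (intro arc_space.subspace_diff arc_space.subspace_scale subspace_cycle_space) auto
  moreover have "y e = 0" if "e \<notin> set p" for e
    using that assms(3) by (cases "e = a") (auto simp: y_def arc_scale_def c p(1))
  ultimately have "y = 0"
    using circulation_on_path_eq_0[of y "head G a" p u] p by auto
  then show ?thesis unfolding y_def by auto
qed

text \<open>By conservation, each arc of positive value is preceded by another such arc. Walking
  backward long enough repeats a vertex and closes a directed cycle.\<close>

lemma (in fin_digraph) positive_circulation_contains_directed_cycle:
  assumes x: "x \<in> cycle_space G" "\<And>e. 0 \<le> x e" and "x \<noteq> 0"
  shows "\<exists>c\<in>directed_cycles G. \<forall>e. c e \<noteq> 0 \<longrightarrow> 0 < x e"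
proof -
  define H where "H = G\<lparr>arcs := {e \<in> arcs G. 0 < x e}\<rparr>"
  have [simp]: "verts H = verts G" "arcs H = {e \<in> arcs G. 0 < x e}" "tail H = tail G" "head H = head G"
    by (auto simp: H_def)
  interpret H: fin_digraph H by unfold_locales auto
  have sub: "subgraph H G" by (auto simp: subgraph_def compatible_def wf_digraph H.wf_digraph)
  have zero: "x e = 0" if "e \<notin> arcs G" for e
    using x(1) that by (auto simp: cycle_space_def)
  have pred: "\<exists>b\<in>arcs H. head G b = tail G a" if "a \<in> arcs H" for a
  proof (rule ccontr)
    assume none: "\<not> ?thesis"
    have "x e = 0" if "e \<in> in_arcs G (tail G a)" for e
      using none that x(2)[of e] by (fastforce simp: in_arcs_def)
    then have "(\<Sum>e\<in>out_arcs G (tail G a). x e) = 0"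
      using x(1) that by (simp add: cycle_space_def)
    moreover have "0 < (\<Sum>e\<in>out_arcs G (tail G a). x e)"
      by (rule sum_pos2[where i = a]) (use that x(2) in \<open>auto simp: out_arcs_def\<close>)
    ultimately show False by simp
  qed
  obtain a0 where "x a0 \<noteq> 0" using \<open>x \<noteq> 0\<close> by (auto simp: fun_eq_iff)
  then have a0: "a0 \<in> arcs H" using zero x(2)[of a0] by (cases "a0 \<in> arcs G") auto
  have walk: "\<exists>a p w. H.awalk (tail G a) (a # p) w \<and> length p = n" for n
  proof (induction n)
    case 0
    show ?case using H.arc_implies_awalk[OF a0] by auto
  next
    case (Suc n)
    then obtain a p w where *: "H.awalk (tail G a) (a # p) w" "length p = n" by auto
    then have "a \<in> arcs H" by auto
    then obtain b where "b \<in> arcs H" "head G b = tail G a" using pred by blast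
    with * have "H.awalk (tail G b) (b # a # p) w" "length (a # p) = Suc n"
      by (auto simp: H.awalk_Cons_iff)
    then show ?case by blast
  qed
  \<comment> \<open>A walk with more arcs than \<open>H\<close> has vertices cannot be a
    path.\<close>
  obtain a p w where "H.awalk (tail G a) (a # p) w" "length p = card (verts H)"
    using walk by blast
  then have "\<not> H.apath (tail G a) (a # p) w"
    using H.length_apath_less[of "tail G a" "a # p" w] by auto
  with \<open>H.awalk (tail G a) (a # p) w\<close> have "\<not> distinct (H.awalk_verts (tail G a) (a # p))"
    by (auto simp: H.apath_def)
  from H.awalk_not_distinct_decomp[OF \<open>H.awalk (tail G a) (a # p) w\<close> this]
  obtain r where "H.closed_w r"
    unfolding H.closed_w_def by blast
  then obtain q where q: "H.cycle q" using H.closed_w_imp_cycle by blast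
  then have "set q \<subseteq> arcs H" by (auto simp: H.cycle_def H.awalk_def)
  then have "\<forall>e. (of_bool (e \<in> set q) :: real) \<noteq> 0 \<longrightarrow> 0 < x e" by auto
  moreover have "cycle q" using subgraph_cycle[OF sub q] .
  moreover have "(\<lambda>e. of_bool (e \<in> set q)) \<in> directed_cycles G"
    using \<open>cycle q\<close> by (simp add: directed_cycles_eq)
  ultimately show ?thesis by (intro bexI[of _ "\<lambda>e. of_bool (e \<in> set q)"])
qed

text \<open>Induction on the size of the support: a directed cycle inside it is subtracted with the
  largest multiple that keeps the circulation nonnegative.\<close>

lemma (in fin_digraph) positive_circulation_decomposition:
  assumes "x \<in> cycle_space G" "\<And>e. 0 \<le> x e"
  shows "\<exists>l. (\<forall>c. 0 \<le> l c) \<and> x = (\<Sum>c\<in>directed_cycles G. arc_scale (l c) c)"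
  using assms
proof (induction "card {e. x e \<noteq> 0}" arbitrary: x rule: less_induct)
  case less
  show ?case
  proof (cases "x = 0")
    case True
    then show ?thesis by (intro exI[of _ "\<lambda>_. 0"]) (simp add: arc_space.scale_zero_left)
  next
    case False
    from positive_circulation_contains_directed_cycle[OF less.prems this]
    obtain c where c: "c \<in> directed_cycles G" and pos: "\<And>e. c e \<noteq> 0 \<Longrightarrow> 0 < x e"
      by auto
    have c01: "c e = 0 \<or> c e = 1" for e using directed_cycles_range[OF c] .
    have "c \<noteq> 0" using c directed_cycles_subset_cycles zero_notin_cycles by blast
    then have ne: "{e. c e \<noteq> 0} \<noteq> {}" by (auto simp: fun_eq_iff)
    have fin: "finite {e. y e \<noteq> 0}" if "y \<in> cycle_space G" for y
    proof -
      have "{e. y e \<noteq> 0} \<subseteq> arcs G" using that by (auto simp: cycle_space_def)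
      then show ?thesis by (rule finite_subset) simp
    qed
    have cs: "c \<in> cycle_space G" using c directed_cycles_subset_cycle_space by blast
    \<comment> \<open>The minimum of \<open>x\<close> on the cycle keeps the difference nonnegative
      and makes it 0 at some arc \<open>a\<close>, so the support shrinks.\<close>
    define t where "t = Min (x ` {e. c e \<noteq> 0})"
    have "t \<in> x ` {e. c e \<noteq> 0}" unfolding t_def using fin[OF cs] ne by (intro Min_in) auto
    then obtain a where a: "c a \<noteq> 0" "x a = t" by auto
    have t_le: "t \<le> x e" if "c e \<noteq> 0" for e unfolding t_def using that fin[OF cs] by auto
    define y where "y = x - arc_scale t c"
    have y: "y e = x e - t * c e" for e by (simp add: y_def arc_scale_def)
    have "y \<in> cycle_space G"
      unfolding y_def using less.prems(1) cs
      by (intro arc_space.subspace_diff arc_space.subspace_scale subspace_cycle_space)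
    moreover have y_nonneg: "0 \<le> y e" for e
      using c01[of e] t_le[of e] less.prems(2)[of e] by (auto simp: y)
    moreover have "card {e. y e \<noteq> 0} < card {e. x e \<noteq> 0}"
    proof (rule psubset_card_mono)
      show "finite {e. x e \<noteq> 0}" using fin less.prems(1) .
      have "y a = 0" "x a \<noteq> 0" using a c01[of a] pos[of a] by (auto simp: y)
      moreover have "{e. y e \<noteq> 0} \<subseteq> {e. x e \<noteq> 0}" using pos by (force simp: y)
      ultimately show "{e. y e \<noteq> 0} \<subset> {e. x e \<noteq> 0}" by auto
    qed
    ultimately have "\<exists>l. (\<forall>c. 0 \<le> l c) \<and> y = (\<Sum>c\<in>directed_cycles G. arc_scale (l c) c)"
      by (intro less.hyps)
    then obtain l where l: "\<And>c. 0 \<le> l c" "y = (\<Sum>c\<in>directed_cycles G. arc_scale (l c) c)"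
      by auto
    define l' where "l' d = l d + (if d = c then t else 0)" for d
    have "(\<Sum>d\<in>directed_cycles G. arc_scale (l' d) d)
      = (\<Sum>d\<in>directed_cycles G. arc_scale (l d) d + (if d = c then arc_scale t c else 0))"
      by (intro sum.cong refl) (auto simp: l'_def arc_scale_def algebra_simps fun_eq_iff)
    also have "\<dots> = y + arc_scale t c"
      using c finite_directed_cycles by (simp add: sum.distrib flip: l(2))
    also have "\<dots> = x" by (simp add: y_def)
    finally have "x = (\<Sum>d\<in>directed_cycles G. arc_scale (l' d) d)" ..
    moreover have "0 \<le> l' d" for d using l(1)[of d] pos[OF a(1)] a(2) by (auto simp: l'_def)
    ultimately show ?thesis by (intro exI[of _ l']) simp
  qed
qed

subsection \<open>Blocks\<close>

definition adjacent :: "('a, 'b) pre_digraph \<Rightarrow> 'a \<Rightarrow> 'a \<Rightarrow> bool" where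
  "adjacent D u v \<longleftrightarrow> (\<exists>e\<in>arcs D. tail D e = u \<and> head D e = v \<or> tail D e = v \<and> head D e = u)"

text \<open>Every vertex is joined to the head of the list in both directions of the symmetric
  closure, by induction along the list.\<close>

lemma (in wf_digraph) connected_if_successively_adjacent:
  assumes "verts G = set vs" "vs \<noteq> []" "successively (adjacent G) vs"
  shows "connected G"
proof -
  interpret S: pair_wf_digraph "mk_symmetric G" ..
  have adj: "(u, v) \<in> parcs (mk_symmetric G)" if "adjacent G u v" for u v
    using that unfolding adjacent_def parcs_mk_symmetric by blast
  have hd_reaches: "hd vs \<rightarrow>\<^sup>*\<^bsub>mk_symmetric G\<^esub> v \<and> v \<rightarrow>\<^sup>*\<^bsub>mk_symmetric G\<^esub> hd vs" if "v \<in> set vs" for v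
    \<comment> \<open>The equation for \<open>verts G\<close> is weakened to an inclusion, which the
      tail of the list inherits.\<close>
    using assms(2,3) that eq_refl[OF assms(1)[symmetric]]
  proof (induction vs arbitrary: v)
    case (Cons w vs)
    show ?case
    proof (cases "v = w")
      case True
      then have "v \<in> pverts (mk_symmetric G)" using Cons.prems(4) by simp
      then show ?thesis using True S.reachable_refl by simp
    next
      case False
      then have v: "v \<in> set vs" "vs \<noteq> []" using Cons.prems by auto
      then have "adjacent G w (hd vs)" "successively (adjacent G) vs"
        using Cons.prems(2) v(2) unfolding successively_Cons by blast+
      have "adjacent G (hd vs) w"
        using \<open>adjacent G w (hd vs)\<close> unfolding adjacent_def by blast
      have "set vs \<subseteq> verts G" using Cons.prems(4) by simp
      from Cons.IH[OF v(2) \<open>successively (adjacent G) vs\<close> v(1) this]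
      show ?thesis
        using S.adj_reachable_trans[OF adj[OF \<open>adjacent G w (hd vs)\<close>]]
          S.reachable_adj_trans[OF _ adj[OF \<open>adjacent G (hd vs) w\<close>]]
        by (simp del: with_proj_simps)
    qed
  qed simp
  have "u \<rightarrow>\<^sup>*\<^bsub>mk_symmetric G\<^esub> v" if "u \<in> verts G" "v \<in> verts G" for u v
    using S.reachable_trans[of u "hd vs" v] hd_reaches[of u] hd_reaches[of v] that assms(1) by simp
  then show ?thesis
    using assms(1,2) unfolding connected_def by (intro strongly_connectedI) simp_all
qed

text \<open>Removing \<open>v\<close> from the closed circuit leaves the part after \<open>v\<close>
  followed by the part before it, joined by the closing adjacency. This list still connects all
  remaining vertices.\<close>

lemma (in wf_digraph) not_separable_if_vertex_cycle:
  assumes verts: "verts G = set vs" and "distinct vs" and succ: "successively (adjacent G) vs"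
    and closing: "adjacent G (last vs) (hd vs)"
  shows "\<not> separable G"
  unfolding separable_def
proof (intro notI, elim bexE conjE)
  fix v assume v: "v \<in> verts G" "verts (del_vert v) \<noteq> {}" "\<not> connected (del_vert v)"
  interpret del: wf_digraph "del_vert v" by (rule wf_digraph_del_vert)
  obtain as bs where vs: "vs = as @ v # bs"
    using v(1) split_list[of v vs] verts by auto
  have adj: "adjacent (del_vert v) a b" if "adjacent G a b" "a \<noteq> v" "b \<noteq> v" for a b
    using that by (auto simp: adjacent_def del_vert_simps)
  have nv: "v \<notin> set as" "v \<notin> set bs" using \<open>distinct vs\<close> vs by auto
  have "successively (adjacent G) as" "successively (adjacent G) bs"
    using succ unfolding vs by (auto simp: successively_append_iff successively_Cons)
  moreover have "successively (adjacent (del_vert v)) ws"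
    if "successively (adjacent G) ws" "v \<notin> set ws" for ws
    using that(1) by (rule successively_mono) (use that(2) adj in metis)
  ultimately have "successively (adjacent (del_vert v)) as" "successively (adjacent (del_vert v)) bs"
    using nv by simp_all
  moreover have "adjacent (del_vert v) (last bs) (hd as)" if "as \<noteq> []" "bs \<noteq> []"
    using that closing nv unfolding vs by (intro adj) auto
  ultimately have "successively (adjacent (del_vert v)) (bs @ as)"
    by (auto simp: successively_append_iff)
  moreover have "verts (del_vert v) = set (bs @ as)"
    using verts nv unfolding vs by (auto simp: del_vert_simps)
  ultimately have "connected (del_vert v)"
    using v(2) by (intro del.connected_if_successively_adjacent[of "bs @ as"]) auto
  with v(3) show False by simp
qed

text \<open>Among the subgraphs with \<open>P\<close> that contain \<open>H\<close>, one with the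
  largest total number of vertices and arcs is maximal. This extends a non-separable subgraph to a
  block.\<close>

lemma (in fin_digraph) exists_max_subgraph:
  assumes "P H" "subgraph H G"
  shows "\<exists>K. max_subgraph P K \<and> subgraph H K"
proof -
  define Q where "Q K \<longleftrightarrow> P K \<and> subgraph K G \<and> subgraph H K" for K
  define size where "size K = card (verts K) + card (arcs K)" for K :: "('a, 'b) pre_digraph"
  have wfH: "wf_digraph H" using assms(2) by (auto simp: subgraph_def)
  have "Q H" using assms wf_digraph.subgraph_refl[OF wfH] by (simp add: Q_def)
  moreover have "\<forall>K. Q K \<longrightarrow> size K < card (verts G) + card (arcs G) + 1"
    by (auto simp: Q_def size_def subgraph_def less_Suc_eq_le intro!: add_mono card_mono)
  ultimately obtain K where K: "Q K" and max: "\<And>K'. Q K' \<Longrightarrow> size K' \<le> size K"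
    using ex_has_greatest_nat[of Q H size] by blast
  have "K' = K" if K': "subgraph K K'" "subgraph K' G" "P K'" for K'
  proof -
    have "Q K'" using K K' subgraph_trans by (auto simp: Q_def)
    then have le: "size K' \<le> size K" by (rule max)
    have sub: "verts K \<subseteq> verts K'" "arcs K \<subseteq> arcs K'" and fin: "finite (verts K')" "finite (arcs K')"
      using K'(1,2) fin_digraph_subgraph[OF K'(2)]
      by (auto simp: subgraph_def fin_digraph_def fin_digraph_axioms_def)
    have "card (verts K) \<le> card (verts K')" "card (arcs K) \<le> card (arcs K')"
      using sub fin card_mono by blast+
    then have "card (verts K) = card (verts K')" "card (arcs K) = card (arcs K')"
      using le by (simp_all add: size_def)
    then have "verts K = verts K'" "arcs K = arcs K'"
      using sub fin card_subset_eq by blast+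
    then show ?thesis using K'(1) by (auto simp: subgraph_def compatible_def)
  qed
  then have "max_subgraph P K" using K unfolding max_subgraph_def Q_def by blast
  then show ?thesis using K by (auto simp: Q_def)
qed

text \<open>Cut argument: otherwise \<open>e\<close> alone crosses the boundary of the set
  \<open>S\<close> reached from its head without \<open>e\<close>, and conservation summed over
  \<open>S\<close> gives \<open>x e = 0\<close>.\<close>

lemma (in fin_digraph) reachable_without_arc:
  assumes x: "x \<in> cycle_space G" "x e \<noteq> 0"
  shows "head G e \<rightarrow>\<^sup>*\<^bsub>two_way (del_arc e)\<^esub> tail G e"
proof (rule ccontr)
  assume not_reach: "\<not> ?thesis"
  have e: "e \<in> arcs G" using x by (auto simp: cycle_space_def)
  interpret del: wf_digraph "del_arc e" by (rule wf_digraph_del_arc)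
  interpret W: wf_digraph "two_way (del_arc e)" by (rule del.wf_two_way)
  define S where "S = {v \<in> verts G. head G e \<rightarrow>\<^sup>*\<^bsub>two_way (del_arc e)\<^esub> v}"
  have "head G e \<in> S" using e by (auto simp: S_def W.reachable_refl)
  have "tail G e \<notin> S" using not_reach by (simp add: S_def)
  have same_side: "tail G a \<in> S \<longleftrightarrow> head G a \<in> S" if a: "a \<in> arcs G" "a \<noteq> e" for a
  proof -
    have "(a, b) \<in> arcs (two_way (del_arc e))" for b using a by simp
    from W.in_arcs_imp_in_arcs_ends[OF this[of True]] W.in_arcs_imp_in_arcs_ends[OF this[of False]]
    have "tail G a \<rightarrow>\<^bsub>two_way (del_arc e)\<^esub> head G a" "head G a \<rightarrow>\<^bsub>two_way (del_arc e)\<^esub> tail G a"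
      by simp_all
    then show ?thesis using a by (auto simp: S_def intro: W.reachable_adj_trans)
  qed
  have fin: "finite S" by (simp add: S_def)
  have "0 = (\<Sum>v\<in>S. net_outflow G x v)"
    using x(1) by (simp add: cycle_space_iff_net_outflow)
  also have "\<dots> = (\<Sum>a\<in>arcs G. x a * (of_bool (tail G a \<in> S) - of_bool (head G a \<in> S)))"
    unfolding net_outflow_def
    by (subst sum.swap) (simp add: fin of_bool_def sum_subtractf flip: sum_distrib_left)
  \<comment> \<open>All other arcs have both ends on one side of the cut, while \<open>e\<close>
    enters \<open>S\<close>.\<close>
  also have "\<dots> = (\<Sum>a\<in>arcs G. if a = e then - x e else 0)"
    using same_side \<open>head G e \<in> S\<close> \<open>tail G e \<notin> S\<close> by (intro sum.cong) auto
  also have "\<dots> = - x e" using e by simp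
  finally show False using x(2) by simp
qed

text \<open>
  An arc in the support of a circulation closes an undirected cycle. This cycle is non-separable,
  hence contained in a block, and a block with more than one arc is strongly connected.
\<close>

lemma (in fin_digraph) directed_cycle_through_support:
  assumes blocks: "\<And>B. block G B \<Longrightarrow> strongly_connected B \<or> single_arc B"
    and x: "x \<in> cycle_space G" "x e \<noteq> 0"
  shows "\<exists>c\<in>directed_cycles G. c e = 1"
proof -
  have e: "e \<in> arcs G" using x by (auto simp: cycle_space_def)
  have "\<exists>q. awalk (head G e) q (tail G e) \<and> distinct (awalk_verts (head G e) q)"
  \<comment> \<open>A loop is a directed cycle by itself, with the empty path from head to
    tail.\<close>
  proof (cases "head G e = tail G e")
    case True
    then show ?thesis using e by (intro exI[of _ "[]"]) (auto simp: awalk_Nil_iff)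
  next
    case False
    interpret del: wf_digraph "del_arc e" by (rule wf_digraph_del_arc)
    interpret W: wf_digraph "two_way (del_arc e)" by (rule del.wf_two_way)
    obtain p where p: "W.apath (head G e) p (tail G e)"
      using reachable_without_arc[OF x] W.reachable_apath by blast
    have cas: "W.cas (head G e) p (tail G e)" and parcs: "fst ` set p \<subseteq> arcs G - {e}"
      and dist: "distinct (W.awalk_verts (head G e) p)"
      using p by (auto simp: W.apath_def W.awalk_def)
    have pverts: "set (W.awalk_verts (head G e) p) \<subseteq> verts G"
      using p W.awalk_verts_in_verts[of "head G e" p] by (auto simp: W.apath_def W.awalk_def)
    define vs where "vs = W.awalk_verts (head G e) p"
    have vs: "hd vs = head G e" "last vs = tail G e" "vs \<noteq> []"
      using cas by (auto simp: vs_def W.awhd_if_cas W.awlast_if_cas)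
    \<comment> \<open>\<open>H\<close> is the undirected cycle formed by \<open>e\<close> and the
      path \<open>p\<close>.\<close>
    define H where "H = \<lparr>verts = set vs, arcs = insert e (fst ` set p), tail = tail G, head = head G\<rparr>"
    have [simp]: "verts H = set vs" "arcs H = insert e (fst ` set p)" "tail H = tail G" "head H = head G"
      by (auto simp: H_def)
    have "tail G a \<in> set vs \<and> head G a \<in> set vs" if "(a, b) \<in> set p" for a b
      using that W.set_awalk_verts_cas[OF cas] unfolding vs_def
      by (cases b) (force simp: image_iff)+
    then interpret H: wf_digraph H
      using vs hd_in_set[OF vs(3)] last_in_set[OF vs(3)] by unfold_locales auto
    have sub: "subgraph H G"
      using pverts parcs e wf_digraph H.wf_digraph by (auto simp: subgraph_def compatible_def vs_def)
    have "successively (adjacent H) (W.awalk_verts u q)"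
      if "W.cas u q w" "set q \<subseteq> set p" for u q w
      using that
    proof (induction q arbitrary: u)
      case (Cons a q)
      have "adjacent H (tail (two_way (del_arc e)) a) (head (two_way (del_arc e)) a)"
        using Cons.prems(2) by (cases a) (force simp: adjacent_def)
      moreover have "W.cas (head (two_way (del_arc e)) a) q w" using Cons.prems(1) by simp
      ultimately show ?case
        using Cons W.awhd_if_cas by (auto simp: successively_Cons)
    qed auto
    from this[OF cas] have succ: "successively (adjacent H) vs" by (simp add: vs_def)
    have "connected H"
      using H.connected_if_successively_adjacent[of vs] succ vs(3) by simp
    moreover have "\<not> separable H"
    proof (rule H.not_separable_if_vertex_cycle)
      show "adjacent H (last vs) (hd vs)" using vs by (auto simp: adjacent_def)
    qed (use succ dist in \<open>auto simp: vs_def\<close>)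
    ultimately obtain B where B: "block G B" "subgraph H B"
      using exists_max_subgraph[of "\<lambda>H. connected H \<and> \<not> separable H" H] sub
      unfolding block_def by blast
    \<comment> \<open>The path supplies a second arc of the block, which rules out a single
      arc.\<close>
    have "p \<noteq> []" using cas False by auto
    then obtain a where "a \<in> fst ` set p" by (meson image_eqI list.set_sel(1))
    then have "a \<in> arcs B" "e \<in> arcs B" "a \<noteq> e" using B(2) parcs by (auto simp: subgraph_def)
    then have "strongly_connected B" using blocks[OF B(1)] by (auto simp: single_arc_def)
    moreover have subB: "subgraph B G" using B(1) by (simp add: block_def subgraphI_max_subgraph)
    then interpret B: wf_digraph B by (auto simp: subgraph_def)
    have "tail B = tail G" "head B = head G" using subB by (auto simp: subgraph_def compatible_def)
    then have "tail G e \<in> verts B" "head G e \<in> verts B"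
      using B.wellformed \<open>e \<in> arcs B\<close> by metis+
    ultimately have "head G e \<rightarrow>\<^sup>*\<^bsub>B\<^esub> tail G e" by (auto simp: strongly_connected_def)
    then have "head G e \<rightarrow>\<^sup>* tail G e" using reachable_mono subB by blast
    then show ?thesis using reachable_apath by (auto simp: apath_def)
  qed
  then obtain q where "awalk (head G e) q (tail G e)" "distinct (awalk_verts (head G e) q)"
    by blast
  then have "cycle (e # q)"
    using e unfolding cycle_def by (intro exI[of _ "tail G e"]) (auto simp: awalk_Cons_iff)
  then have "(\<lambda>a. of_bool (a \<in> set (e # q))) \<in> directed_cycles G"
    unfolding directed_cycles_eq by (intro image_eqI[of _ _ "e # q"]) auto
  then show ?thesis by (intro bexI[of _ "\<lambda>a. of_bool (a \<in> set (e # q))"]) auto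
qed

subsection \<open>Forward fundamental bases\<close>

lemma (in fin_digraph) span_directed_cycles:
  assumes "\<And>x e. x \<in> cycle_space G \<Longrightarrow> x e \<noteq> 0 \<Longrightarrow> \<exists>c\<in>directed_cycles G. c e = 1"
  shows "arc_space.span (directed_cycles G) = cycle_space G"
proof (intro equalityI subsetI)
  fix x assume x: "x \<in> cycle_space G"
  define s where "s = (\<Sum>c\<in>directed_cycles G. c)"
  \<comment> \<open>\<open>t\<close> bounds every absolute value of \<open>x\<close>, and
    \<open>s\<close> is at least 1 wherever \<open>x\<close> is nonzero, so \<open>x + t s\<close>
    is nonnegative.\<close>
  define t where "t = (\<Sum>e\<in>arcs G. \<bar>x e\<bar>)"
  define y where "y = x + arc_scale t s"
  have s_span: "s \<in> arc_space.span (directed_cycles G)"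
    unfolding s_def by (intro arc_space.span_sum arc_space.span_base)
  then have s: "s \<in> cycle_space G"
    using arc_space.span_minimal[OF directed_cycles_subset_cycle_space subspace_cycle_space] by auto
  have "y \<in> cycle_space G"
    unfolding y_def
    by (intro arc_space.subspace_add arc_space.subspace_scale subspace_cycle_space x s)
  moreover have "0 \<le> y e" for e
  proof -
    have s_eq: "s e = (\<Sum>c\<in>directed_cycles G. c e)"
      unfolding s_def by (induction rule: infinite_finite_induct) auto
    have c_nonneg: "0 \<le> c e" if "c \<in> directed_cycles G" for c
      using directed_cycles_range[OF that, of e] by auto
    have t_nonneg: "0 \<le> t" unfolding t_def by (intro sum_nonneg) auto
    show ?thesis
    proof (cases "x e = 0")
      case True
      then show ?thesis
        using c_nonneg t_nonneg by (auto simp: y_def arc_scale_def s_eq intro!: mult_nonneg_nonneg sum_nonneg)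
    next
      case False
      then obtain c where c: "c \<in> directed_cycles G" "c e = 1" using assms x by blast
      have "e \<in> arcs G" using False x by (auto simp: cycle_space_def)
      then have "\<bar>x e\<bar> \<le> t" unfolding t_def by (intro member_le_sum) auto
      moreover have "c e \<le> s e"
        unfolding s_eq using c_nonneg c(1) finite_directed_cycles by (intro member_le_sum) auto
      then have "t * 1 \<le> t * s e"
        using t_nonneg c(2) by (intro mult_left_mono) auto
      ultimately show ?thesis by (simp add: y_def arc_scale_def)
    qed
  qed
  ultimately have "\<exists>l. (\<forall>c. 0 \<le> l c) \<and> y = (\<Sum>c\<in>directed_cycles G. arc_scale (l c) c)"
    by (rule positive_circulation_decomposition)
  then have "y \<in> arc_space.span (directed_cycles G)"
    by (auto simp: arc_space.span_sum arc_space.span_scale arc_space.span_base)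
  then have "y - arc_scale t s \<in> arc_space.span (directed_cycles G)"
    using s_span by (intro arc_space.span_diff arc_space.span_scale)
  then show "x \<in> arc_space.span (directed_cycles G)" by (simp add: y_def)
next
  fix x assume "x \<in> arc_space.span (directed_cycles G)"
  then show "x \<in> cycle_space G"
    using arc_space.span_minimal[OF directed_cycles_subset_cycle_space subspace_cycle_space] by auto
qed

text \<open>A redundant vector could be dropped, leaving a spanning set with fewer than
  \<open>dim V\<close> elements.\<close>

lemma (in vector_space) independent_if_card_eq_dim:
  assumes "finite B" "span B = V" "card B = dim V"
  shows "independent B"
proof
  assume "dependent B"
  then obtain b where b: "b \<in> B" "b \<in> span (B - {b})" by (auto simp: dependent_def)
  then have "V \<subseteq> span (B - {b})"
    using assms(2) span_redundant[OF b(2)] by (simp add: insert_absorb)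
  then have "dim V \<le> card (B - {b})"
    using assms(1) by (intro dim_le_card) auto
  also have "\<dots> < card B" using b(1) assms(1) by (intro psubset_card_mono) auto
  finally show False using assms(3) by simp
qed

text \<open>
  If all arcs of a directed cycle \<open>c\<close> were shared with other directed cycles, then a sum of other
  directed cycles would dominate \<open>c\<close>, and decomposing the difference would put \<open>c\<close> in the span of
  the other directed cycles.
\<close>

lemma (in fin_digraph) private_arc_if_independent:
  assumes indep: "arc_space.independent (directed_cycles G)" and c: "c \<in> directed_cycles G"
  shows "\<exists>e. c e = 1 \<and> (\<forall>d\<in>directed_cycles G. d \<noteq> c \<longrightarrow> d e = 0)"
proof (rule ccontr)
  let ?F = "directed_cycles G"
  assume none: "\<not> ?thesis"
  define A where "A = {e. c e = 1}"
  have "\<forall>e\<in>A. \<exists>d. d \<in> ?F - {c} \<and> d e = 1"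
    using none directed_cycles_range by (fastforce simp: A_def)
  then obtain f where f: "\<And>e. e \<in> A \<Longrightarrow> f e \<in> ?F - {c} \<and> f e e = 1" by metis
  have cs: "c \<in> cycle_space G" using c directed_cycles_subset_cycle_space by auto
  have "A \<subseteq> arcs G" using cs by (auto simp: A_def cycle_space_def)
  then have fin: "finite A" by (rule finite_subset) simp
  \<comment> \<open>One other directed cycle is taken through each arc of \<open>c\<close>, so
    \<open>s\<close> is at least 1 on the support of \<open>c\<close>.\<close>
  define s where "s = (\<Sum>e\<in>A. f e)"
  have s_span: "s \<in> arc_space.span (?F - {c})"
    unfolding s_def using f by (intro arc_space.span_sum arc_space.span_base) auto
  have "s \<in> cycle_space G"
    unfolding s_def using f directed_cycles_subset_cycle_space
    by (intro arc_space.subspace_sum subspace_cycle_space) auto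
  then have "s - c \<in> cycle_space G"
    using cs by (intro arc_space.subspace_diff subspace_cycle_space)
  moreover have "0 \<le> (s - c) e" for e
  proof -
    have s_eq: "s e = (\<Sum>a\<in>A. f a e)"
      unfolding s_def by (induction rule: infinite_finite_induct) auto
    have nonneg: "0 \<le> f a e" if "a \<in> A" for a
      using f[OF that] directed_cycles_range[of "f a" e] by auto
    show ?thesis
    proof (cases "e \<in> A")
      case True
      have "f e e \<le> s e" unfolding s_eq using nonneg fin True by (intro member_le_sum) auto
      then show ?thesis using True f[OF True] by (simp add: A_def)
    next
      case False
      then have "c e = 0" using directed_cycles_range[OF c, of e] by (auto simp: A_def)
      then show ?thesis using nonneg by (auto simp: s_eq intro!: sum_nonneg)
    qed
  qed
  ultimately have "\<exists>l. (\<forall>d. 0 \<le> l d) \<and> s - c = (\<Sum>d\<in>?F. arc_scale (l d) d)"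
    by (rule positive_circulation_decomposition)
  then obtain l where l: "\<And>d. 0 \<le> l d" and sc: "s - c = (\<Sum>d\<in>?F. arc_scale (l d) d)" by auto
  \<comment> \<open>The term of \<open>c\<close> is moved to the other side. Its coefficient becomes
    \<open>1 + l c\<close>, which is positive and can be inverted.\<close>
  have "(\<Sum>d\<in>?F. arc_scale (l d) d) = arc_scale (l c) c + (\<Sum>d\<in>?F - {c}. arc_scale (l d) d)"
    using c finite_directed_cycles by (rule sum.remove[rotated])
  then have "arc_scale (1 + l c) c = s - (\<Sum>d\<in>?F - {c}. arc_scale (l d) d)"
    using sc by (simp add: arc_space.scale_left_distrib algebra_simps)
  moreover have "s - (\<Sum>d\<in>?F - {c}. arc_scale (l d) d) \<in> arc_space.span (?F - {c})"
    by (intro arc_space.span_diff[OF s_span] arc_space.span_sum arc_space.span_scale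
        arc_space.span_base)
  ultimately have "arc_scale (1 + l c) c \<in> arc_space.span (?F - {c})" by simp
  then have "arc_scale (inverse (1 + l c)) (arc_scale (1 + l c) c) \<in> arc_space.span (?F - {c})"
    by (rule arc_space.span_scale)
  moreover have "1 + l c \<noteq> 0" using l[of c] by simp
  ultimately have "c \<in> arc_space.span (?F - {c})" by simp
  then show False using indep c by (auto simp: arc_space.dependent_def)
qed

text \<open>The coordinates of a circulation are its values at the private arcs. Vanishing at all of
  them forces 0, so deleting them leaves a forest. Vanishing at all but \<open>f c\<close> forces a
  multiple of \<open>c\<close>, so restoring \<open>f c\<close> creates only \<open>c\<close> and
  its reverse.\<close>

lemma (in fin_digraph) fundamental_if_private_arcs:
  assumes basis: "cycle_basis G B"
    and private_arc: "\<And>c. c \<in> B \<Longrightarrow> \<exists>e. c e = 1 \<and> (\<forall>d\<in>B. d \<noteq> c \<longrightarrow> d e = 0)"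
    and "finite B"
  shows "fundamental_cycle_basis G B"
proof -
  obtain f where f: "\<And>c. c \<in> B \<Longrightarrow> c (f c) = 1"
    and f_other: "\<And>c d. c \<in> B \<Longrightarrow> d \<in> B \<Longrightarrow> d \<noteq> c \<Longrightarrow> d (f c) = 0"
    using private_arc by metis
  have B: "B \<subseteq> cycles G" and span: "arc_space.span B = cycle_space G"
    using basis by (auto simp: cycle_basis_def)
  have zero: "c e = 0" if "c \<in> cycles G" "e \<notin> arcs G" for c e
    using that cycles_subset_cycle_space by (auto simp: cycle_space_def)
  define T where "T = G\<lparr>arcs := arcs G - f ` B\<rparr>"
  have [simp]: "verts T = verts G" "arcs T = arcs G - f ` B" "tail T = tail G" "head T = head G"
    by (auto simp: T_def)
  have "f c \<in> arcs G" if "c \<in> B" for c using zero[of c "f c"] f that B by force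
  then have fB: "f ` B \<subseteq> arcs G" by blast
  have wfT: "wf_digraph T" by unfold_locales auto
  have subT: "subgraph T G" using wfT wf_digraph by (auto simp: subgraph_def compatible_def)
  have coeff: "\<exists>r. x = (\<Sum>b\<in>B. arc_scale (r b) b) \<and> (\<forall>b\<in>B. r b = x (f b))"
    if x: "x \<in> cycle_space G" for x
  proof -
    obtain r where r: "x = (\<Sum>b\<in>B. arc_scale (r b) b)"
      using x \<open>finite B\<close> unfolding span[symmetric] by (auto simp: arc_space.span_finite)
    have sum_at: "(\<Sum>b\<in>B'. arc_scale (r b) b) e = (\<Sum>b\<in>B'. r b * b e)" for B' e
      by (induction B' rule: infinite_finite_induct) (auto simp: arc_scale_def)
    have "x (f b) = r b" if "b \<in> B" for b
    proof -
      have "x (f b) = (\<Sum>d\<in>B. if d = b then r b else 0)"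
        unfolding r sum_at using f[OF that] f_other[OF that] by (intro sum.cong) auto
      then show ?thesis using that \<open>finite B\<close> by simp
    qed
    with r show ?thesis by auto
  qed
  have "cycles T = {}"
  proof (rule ccontr)
    assume "cycles T \<noteq> {}"
    then obtain x where x: "x \<in> cycles G" "\<And>e. e \<notin> arcs T \<Longrightarrow> x e = 0"
      by (auto simp: cycles_subgraph[OF subT])
    then obtain r where r: "x = (\<Sum>b\<in>B. arc_scale (r b) b)" "\<And>b. b \<in> B \<Longrightarrow> r b = x (f b)"
      using coeff cycles_subset_cycle_space by blast
    have "r b = 0" if "b \<in> B" for b using r(2)[OF that] x(2)[of "f b"] that by simp
    then have "x = 0" unfolding r(1) by (intro sum.neutral) simp
    then show False using x(1) zero_notin_cycles by metis
  qed
  then have "spanning_forest T G" using subT by (auto simp: spanning_forest_def spanning_def)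
  moreover have "inj_on f B" using f f_other by (intro inj_onI) (metis zero_neq_one)
  moreover have "fundamental_cycle T (f c) c" if c: "c \<in> B" for c
  proof -
    have fc: "f c \<in> arcs G" using fB c by auto
    define T' where "T' = pre_digraph.add_arc T (f c)"
    have "wf_digraph T'" unfolding T'_def by (rule wf_digraph.wf_digraph_add_arc[OF wfT])
    then have subT': "subgraph T' G"
      using fc wf_digraph wellformed
      by (auto simp: subgraph_def compatible_def T'_def pre_digraph.add_arc_def)
    have arcsT': "arcs T' = insert (f c) (arcs G - f ` B)" by (simp add: T'_def pre_digraph.add_arc_def)
    have "cycles T' = {c, - c}"
    proof (intro equalityI subsetI)
      fix x assume "x \<in> cycles T'"
      then have x: "x \<in> cycles G" "\<And>e. e \<notin> arcs T' \<Longrightarrow> x e = 0"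
        by (auto simp: cycles_subgraph[OF subT'])
      then obtain r where r: "x = (\<Sum>b\<in>B. arc_scale (r b) b)" "\<And>b. b \<in> B \<Longrightarrow> r b = x (f b)"
        using coeff cycles_subset_cycle_space by blast
      have "r b = 0" if "b \<in> B" "b \<noteq> c" for b
      proof -
        have "f b \<noteq> f c" using that c \<open>inj_on f B\<close> by (auto dest: inj_onD)
        then have "f b \<notin> arcs T'" using that by (simp add: arcsT')
        then show ?thesis using r(2)[OF that(1)] x(2) by simp
      qed
      then have "x = (\<Sum>b\<in>B. if b = c then arc_scale (r c) c else 0)"
        unfolding r(1) by (intro sum.cong) auto
      then have x_eq: "x = arc_scale (r c) c" using c \<open>finite B\<close> by simp
      \<comment> \<open>The scalar is an entry of the cycle \<open>x\<close>, and 0 is excluded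
        because the zero vector is no cycle.\<close>
      have "r c \<in> {-1, 0, 1}" using r(2)[OF c] cycles_range[OF x(1)] by metis
      moreover have "r c \<noteq> 0" using x_eq x(1) zero_notin_cycles arc_space.scale_zero_left by metis
      ultimately show "x \<in> {c, - c}" using x_eq by auto
    next
      fix x assume x: "x \<in> {c, - c}"
      have "c \<in> cycles G" using c B by auto
      moreover have "c e = 0" if "e \<notin> arcs T'" for e
        using that zero[OF \<open>c \<in> cycles G\<close>] f_other c unfolding arcsT' by (cases "e \<in> arcs G") auto
      ultimately show "x \<in> cycles T'"
        using x uminus_cycles by (auto simp: cycles_subgraph[OF subT'])
    qed
    then show ?thesis by (simp add: fundamental_cycle_def T'_def)
  qed
  moreover have "arcs G - arcs T = f ` B" using fB by auto
  ultimately show ?thesis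
    using basis unfolding fundamental_cycle_basis_def
    \<comment> \<open>\<open>inv_into B f\<close> sends each deleted arc back to the basis cycle
      that owns it.\<close>
    by (intro conjI exI[of _ T] exI[of _ "inv_into B f"]) auto
qed

text \<open>Each basis cycle \<open>C e\<close> is 1 at \<open>e\<close>, where all other basis
  cycles vanish. A directed cycle is then a sum of basis cycles without cancellation, and minimality
  of supports leaves only one.\<close>

lemma (in fin_digraph) forward_fundamental_eq_directed_cycles:
  assumes forward: "forward_cycle_basis G B" and fundamental: "fundamental_cycle_basis G B"
  shows "B = directed_cycles G"
proof
  show BF: "B \<subseteq> directed_cycles G" using forward by (simp add: forward_cycle_basis_def)
  then have "finite B" using finite_directed_cycles finite_subset by auto
  have span: "arc_space.span B = cycle_space G"
    using forward by (simp add: forward_cycle_basis_def cycle_basis_def)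
  obtain T C where T: "spanning_forest T G"
    and C: "\<And>e. e \<in> arcs G - arcs T \<Longrightarrow> fundamental_cycle T e (C e)" and B: "B = C ` (arcs G - arcs T)"
    using fundamental by (auto simp: fundamental_cycle_basis_def)
  have subT: "subgraph T G" and wfT: "wf_digraph T" and noT: "cycles T = {}"
    and tT: "tail T = tail G" "head T = head G"
    using T by (auto simp: spanning_forest_def spanning_def subgraph_def compatible_def)
  have outside: "C e a = 0" if e: "e \<in> arcs G - arcs T" and a: "a \<notin> arcs T" "a \<noteq> e" for e a
  proof -
    have "wf_digraph (pre_digraph.add_arc T e)" by (rule wf_digraph.wf_digraph_add_arc[OF wfT])
    then have "subgraph (pre_digraph.add_arc T e) G"
      using e subT tT wf_digraph wellformed
      by (auto simp: subgraph_def compatible_def pre_digraph.add_arc_def)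
    moreover have "C e \<in> cycles (pre_digraph.add_arc T e)"
      using C[OF e] by (simp add: fundamental_cycle_def)
    ultimately show ?thesis
      using a by (auto simp: cycles_subgraph pre_digraph.add_arc_def)
  qed
  \<comment> \<open>A cycle avoiding \<open>e\<close> would lie in the forest. Directedness then
    fixes the sign.\<close>
  have own: "C e e = 1" if e: "e \<in> arcs G - arcs T" for e
  proof (rule ccontr)
    have Ce: "C e \<in> directed_cycles G" using B BF e by auto
    assume "C e e \<noteq> 1"
    then have "C e e = 0" using directed_cycles_range[OF Ce, of e] by auto
    then have "C e a = 0" if "a \<notin> arcs T" for a using outside[OF e that] by (cases "a = e") auto
    then have "C e \<in> cycles T"
      using Ce directed_cycles_subset_cycles by (auto simp: cycles_subgraph[OF subT])
    then show False using noT by simp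
  qed
  show "directed_cycles G \<subseteq> B"
  proof
    fix c assume c: "c \<in> directed_cycles G"
    then have "c \<in> arc_space.span B"
      using span directed_cycles_subset_cycle_space by auto
    then obtain r where r: "c = (\<Sum>b\<in>B. arc_scale (r b) b)"
      using \<open>finite B\<close> by (auto simp: arc_space.span_finite)
    have c_at: "c a = (\<Sum>b\<in>B. r b * b a)" for a
      unfolding r by (induction B rule: infinite_finite_induct) (auto simp: arc_scale_def)
    have r01: "r b = 0 \<or> r b = 1" if b: "b \<in> B" for b
    proof -
      obtain e where e: "e \<in> arcs G - arcs T" "b = C e" using b B by auto
      have "d e = 0" if "d \<in> B" "d \<noteq> b" for d
        using that e outside unfolding B by auto
      then have "c e = (\<Sum>d\<in>B. if d = b then r b else 0)"
        unfolding c_at using own[OF e(1)] e(2) by (intro sum.cong) auto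
      then have "c e = r b" using b \<open>finite B\<close> by simp
      then show ?thesis using directed_cycles_range[OF c, of e] by simp
    qed
    have "c \<noteq> 0" using c directed_cycles_subset_cycles zero_notin_cycles by blast
    have "\<exists>b\<in>B. r b \<noteq> 0"
    proof (rule ccontr)
      assume "\<not> ?thesis"
      then have "c = 0" unfolding r by (intro sum.neutral) simp
      with \<open>c \<noteq> 0\<close> show False ..
    qed
    then obtain b where b: "b \<in> B" "r b \<noteq> 0" ..
    then have bF: "b \<in> directed_cycles G" using BF by auto
    \<comment> \<open>All terms in the expansion of \<open>c a\<close> are nonnegative, so each of
      them is 0.\<close>
    have "b a = 0" if "c a = 0" for a
    proof -
      have "0 \<le> r d * d a" if "d \<in> B" for d
        using r01[OF that] directed_cycles_range[OF subsetD[OF BF that], of a] by auto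
      then have "r b * b a = 0"
        using \<open>c a = 0\<close> \<open>finite B\<close> b(1) unfolding c_at by (simp add: sum_nonneg_eq_0_iff)
      then show ?thesis using b(2) by simp
    qed
    then obtain t where t: "b = arc_scale t c"
      using directed_cycle_minimal_support[OF c, of b] bF directed_cycles_subset_cycle_space by blast
    have "b \<noteq> 0" using bF directed_cycles_subset_cycles zero_notin_cycles by blast
    then obtain a where "b a \<noteq> 0" by (auto simp: fun_eq_iff)
    \<comment> \<open>Both vectors take only the values 0 and 1, so the factor \<open>t\<close> is
      1.\<close>
    then have "b a = 1" "c a = 1" "b a = t * c a"
      using directed_cycles_range[OF bF, of a] directed_cycles_range[OF c, of a] t
      by (auto simp: arc_scale_def)
    then have "b = c" using t by simp
    then show "c \<in> B" using b(1) by simp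
  qed
qed

theorem theorem3p4:
  fixes D :: "('a, 'b) pre_digraph"
  assumes "fin_digraph D"
    and "\<And>B. block D B \<Longrightarrow> strongly_connected B \<or> single_arc B"
  shows "((\<exists>B. forward_cycle_basis D B \<and> fundamental_cycle_basis D B)
            \<longleftrightarrow> card (directed_cycles D) = cycle_rank D)
         \<and> (card (directed_cycles D) = cycle_rank D
            \<longrightarrow> (\<forall>B. forward_cycle_basis D B \<longleftrightarrow> B = directed_cycles D))"
proof -
  interpret fin_digraph D by fact
  let ?F = "directed_cycles D"
  \<comment> \<open>The assumption on blocks enters here: it puts a directed cycle through every arc
    that carries a circulation.\<close>
  have span: "arc_space.span ?F = cycle_space D"
    using assms(2) by (intro span_directed_cycles directed_cycle_through_support)
  have card_basis: "card B = cycle_rank D" if "forward_cycle_basis D B" for B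
  proof -
    have "arc_space.independent B" "arc_space.span B = cycle_space D"
      using that by (auto simp: forward_cycle_basis_def cycle_basis_def)
    then show ?thesis
      unfolding cycle_rank_def by (metis arc_space.dim_span_eq_card_independent)
  qed
  have forward_iff: "forward_cycle_basis D B \<longleftrightarrow> B = ?F" if card: "card ?F = cycle_rank D" for B
  proof
    assume B: "forward_cycle_basis D B"
    then have "B \<subseteq> ?F" by (simp add: forward_cycle_basis_def)
    \<comment> \<open>A forward basis has \<open>cycle_rank D\<close> elements and lies in a finite
      set of that size.\<close>
    then show "B = ?F"
      using card_basis[OF B] card finite_directed_cycles by (intro card_subset_eq) auto
  next
    assume "B = ?F"
    moreover have "arc_space.independent ?F"
      using finite_directed_cycles span card unfolding cycle_rank_def
      by (rule arc_space.independent_if_card_eq_dim)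
    ultimately show "forward_cycle_basis D B"
      using span directed_cycles_subset_cycles by (simp add: forward_cycle_basis_def cycle_basis_def)
  qed
  have "card ?F = cycle_rank D" if "forward_cycle_basis D B" "fundamental_cycle_basis D B" for B
    using forward_fundamental_eq_directed_cycles[OF that] card_basis[OF that(1)] by simp
  moreover have "fundamental_cycle_basis D ?F" if "card ?F = cycle_rank D"
  proof (rule fundamental_if_private_arcs)
    show basis: "cycle_basis D ?F"
      using forward_iff[OF that, of ?F] by (simp add: forward_cycle_basis_def)
    show "\<exists>e. c e = 1 \<and> (\<forall>d\<in>?F. d \<noteq> c \<longrightarrow> d e = 0)" if "c \<in> ?F" for c
      using basis that by (intro private_arc_if_independent) (auto simp: cycle_basis_def)
  qed (rule finite_directed_cycles)
  ultimately show ?thesis using forward_iff by blast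
qed

end
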